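(* Let $k,n$ be integers with $k\ge 4$ and $\ell(k-1)<n\le \ell(k)$, where $\ell(m)=\frac{m^3-m^2}{2}=m\binom{m}{2}$. Then: (1) $\chi_{NL}(P_n)=k$; (2) $\chi_{NL}(C_n)=k$ if $n\neq \ell(k)-1$; (3) $\chi_{NL}(C_n)=k+1$ if $n=\ell(k)-1$. Here $P_n$ and $C_n$ denote the path and the cycle of order $n$.
   Context: All graphs are finite, simple, undirected and connected. A $k$-coloring of a graph $G$ is a partition of $V(G)$ into $k$ independent sets (colors). A coloring $\{S_1,\dots,S_k\}$ is neighbor-locating (an NL-coloring) if for any two distinct vertices $u,v$ in the same color class, $\{j: N(u)\cap S_j\neq\emptyset\}\neq\{j: N(v)\cap S_j\neq\emptyset\}$. The neighbor-locating chromatic number $\chi_{NL}(G)$ is the minimum number of colors in an NL-coloring of $G$. *)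

theory Defs
  imports "HOL-Library.Disjoint_Sets" "Graph_Theory.Pair_Digraph"
begin

text \<open>A finite simple undirected graph is a \<^locale>\<open>pair_graph\<close>: its arc set is symmetric and loop-free,
  and an edge \<open>{u,v}\<close> is represented by the two arcs \<open>(u,v)\<close> and \<open>(v,u)\<close>.\<close>

definition nbhd :: "'a pair_pre_digraph \<Rightarrow> 'a \<Rightarrow> 'a set" where
  "nbhd G v = {u. (v, u) \<in> parcs G}"

definition independent_set :: "'a pair_pre_digraph \<Rightarrow> 'a set \<Rightarrow> bool" where
  "independent_set G S \<longleftrightarrow> S \<subseteq> pverts G \<and> (\<forall>u\<in>S. \<forall>v\<in>S. (u, v) \<notin> parcs G)"

text \<open>The colors are the (nonempty) parts themselves, so the number of colors is \<^term>\<open>card P\<close>.\<close>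

definition coloring :: "'a pair_pre_digraph \<Rightarrow> 'a set set \<Rightarrow> bool" where
  "coloring G P \<longleftrightarrow> partition_on (pverts G) P \<and> (\<forall>S\<in>P. independent_set G S)"

definition nl_coloring :: "'a pair_pre_digraph \<Rightarrow> 'a set set \<Rightarrow> bool" where
  "nl_coloring G P \<longleftrightarrow> coloring G P \<and>
     (\<forall>S\<in>P. \<forall>u\<in>S. \<forall>v\<in>S. u \<noteq> v \<longrightarrow>
        {T \<in> P. nbhd G u \<inter> T \<noteq> {}} \<noteq> {T \<in> P. nbhd G v \<inter> T \<noteq> {}})"

definition chi_NL :: "'a pair_pre_digraph \<Rightarrow> nat" where
  "chi_NL G = (LEAST k. \<exists>P. nl_coloring G P \<and> card P = k)"

definition path_graph :: "nat \<Rightarrow> nat pair_pre_digraph" where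
  "path_graph n = \<lparr> pverts = {..<n},
     parcs = {(i, j). i < n \<and> j < n \<and> (j = i + 1 \<or> i = j + 1)} \<rparr>"

text \<open>Meaningful for \<open>n \<ge> 3\<close>: for \<open>n = 1\<close> the arc \<open>(0,0)\<close> is a loop, and for \<open>n = 2\<close> this is a single edge.\<close>

definition cycle_graph :: "nat \<Rightarrow> nat pair_pre_digraph" where
  "cycle_graph n = \<lparr> pverts = {..<n},
     parcs = {(i, j). i < n \<and> j < n \<and> (j = (i + 1) mod n \<or> i = (j + 1) mod n)} \<rparr>"

definition ell :: "nat \<Rightarrow> nat" where
  "ell m = (m ^ 3 - m ^ 2) div 2"

lemma ell_eq_choose: "ell m = m * (m choose 2)"
proof -
  have "m ^ 3 - m ^ 2 = m * (m * (m - 1))"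
    by (simp add: power2_eq_square power3_eq_cube diff_mult_distrib2)
  moreover have "even (m * (m - 1))"
    by (cases m) auto
  ultimately show ?thesis
    by (simp only: ell_def choose_two div_mult_swap)
qed

lemma pair_graph_path_graph: "pair_graph (path_graph n)"
proof
  show "finite (parcs (path_graph n))"
    by (rule finite_subset[of _ "{..<n} \<times> {..<n}"]) (auto simp: path_graph_def)
qed (auto simp: path_graph_def symmetric_def arcs_ends_def arc_to_ends_def intro!: symI)

lemma pair_graph_cycle_graph:
  assumes "n \<ge> 3"
  shows "pair_graph (cycle_graph n)"
proof
  show "finite (parcs (cycle_graph n))"
    by (rule finite_subset[of _ "{..<n} \<times> {..<n}"]) (auto simp: cycle_graph_def)
  show "fst e \<noteq> snd e" if "e \<in> parcs (cycle_graph n)" for e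
    using that assms by (auto simp: cycle_graph_def mod_Suc split: if_splits)
qed (auto simp: cycle_graph_def symmetric_def arcs_ends_def arc_to_ends_def intro!: symI)

lemma nl_coloring_singletons:
  assumes "pair_graph G"
  shows "nl_coloring G ((\<lambda>v. {v}) ` pverts G)"
proof -
  interpret pair_graph G by fact
  show ?thesis
    by (auto simp: nl_coloring_def coloring_def independent_set_def partition_on_def
        disjoint_def dest: no_loops)
qed

end

theory Submission
  imports Defs "HOL-Library.Ramsey"
begin

text \<open>Describe a vertex of color \<open>x\<close> by its location \<open>(x, B)\<close>, where \<open>B\<close> is the set of colors on its closed
  neighborhood. In a path or cycle \<open>B\<close> has two or three elements, so with \<open>m\<close> colors there are
  \<open>2 (m choose 2) + 3 (m choose 3) = ell m\<close> possible locations, and in an NL-coloring they are all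
  distinct; this is the lower bound. Conversely, if the colors \<open>a\<close>, \<open>b\<close> appear next to each other in
  a color sequence, replacing \<open>a b\<close> by \<open>a b a b\<close> or by \<open>a b c a b\<close> keeps all old locations and adds
  exactly the locations \<open>(x, B)\<close>, \<open>x \<in> B\<close>, for \<open>B = {a, b}\<close> or \<open>B = {a, b, c}\<close>. Starting from
  the sequence \<open>0 1\<close>, any set of blocks \<open>B\<close> that is suitably connected can be inserted, and pairs and
  triples together give every length except \<open>ell k - 1\<close>. The sequence starts and ends with \<open>0 1\<close>,
  so it colors the path as well as the cycle. For the path with \<open>ell k - 1\<close> vertices one
  starts from \<open>0 1 0 2 1 2\<close> instead. A cycle with \<open>ell k - 1\<close> vertices would miss exactly one location
  \<open>(c, B)\<close>; counting for \<open>a \<in> B - {c}\<close> the edges between colors \<open>a\<close> and \<open>c\<close> from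
  both sides gives different numbers.\<close>

section \<open>NL-colorings as functions\<close>

text \<open>The closed neighborhood is used instead of the open one: for proper functions this
  distinguishes the same vertices.\<close>

definition location :: "'a pair_pre_digraph \<Rightarrow> ('a \<Rightarrow> 'c) \<Rightarrow> 'a \<Rightarrow> 'c \<times> 'c set" where
  "location G f u = (f u, insert (f u) (f ` nbhd G u))"

definition nl_function :: "'a pair_pre_digraph \<Rightarrow> ('a \<Rightarrow> 'c) \<Rightarrow> bool" where
  "nl_function G f \<longleftrightarrow> (\<forall>(u, v) \<in> parcs G. f u \<noteq> f v) \<and> inj_on (location G f) (pverts G)"

text \<open>A proper function never uses the color of a vertex on its open neighborhood, so adding
  that color to the image loses no information.\<close>

lemma location_eq_iff:
  assumes "\<And>u v. (u, v) \<in> parcs G \<Longrightarrow> f u \<noteq> f v"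
  shows "location G f u = location G f v \<longleftrightarrow> f u = f v \<and> f ` nbhd G u = f ` nbhd G v"
proof -
  have "f w \<notin> f ` nbhd G w" for w
    using assms by (force simp: nbhd_def)
  then show ?thesis
    unfolding location_def by (metis insert_ident prod.inject)
qed

lemma nl_coloring_of_function:
  assumes G: "pair_graph G" and f: "nl_function G f"
  shows "\<exists>P. nl_coloring G P \<and> card P = card (f ` pverts G)"
proof -
  interpret pair_graph G by fact
  define cls where "cls c = {v \<in> pverts G. f v = c}" for c
  define P where "P = cls ` f ` pverts G"
  have inj: "inj_on cls (f ` pverts G)"
    by (auto simp: inj_on_def cls_def)
  have part: "partition_on (pverts G) P"
    by (auto simp: P_def cls_def partition_on_def disjoint_def)
  have indep: "independent_set G S" if "S \<in> P" for S
    using that f by (force simp: P_def cls_def independent_set_def nl_function_def)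
  have nb_sub: "nbhd G u \<subseteq> pverts G" for u
    by (auto simp: nbhd_def dest: wellformed)
  then have sub: "f ` nbhd G u \<subseteq> f ` pverts G" for u
    by blast
  \<comment> \<open>\<open>cls\<close> is injective on the used colors, and a class meets
    \<open>nbhd G u\<close> exactly when its color occurs there; hence sets of classes and sets of
    colors carry the same information.\<close>
  have nb: "{T \<in> P. nbhd G u \<inter> T \<noteq> {}} = cls ` f ` nbhd G u" for u
  proof -
    have "nbhd G u \<inter> cls c \<noteq> {} \<longleftrightarrow> c \<in> f ` nbhd G u" for c
      using nb_sub[of u] unfolding cls_def by blast
    then show ?thesis
      using sub[of u] unfolding P_def by blast
  qed
  have "{T \<in> P. nbhd G u \<inter> T \<noteq> {}} \<noteq> {T \<in> P. nbhd G v \<inter> T \<noteq> {}}"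
    if "S \<in> P" "u \<in> S" "v \<in> S" "u \<noteq> v" for S u v
  proof
    assume "{T \<in> P. nbhd G u \<inter> T \<noteq> {}} = {T \<in> P. nbhd G v \<inter> T \<noteq> {}}"
    then have "f ` nbhd G u = f ` nbhd G v"
      using inj_on_image_eq_iff[OF inj sub sub] by (simp add: nb)
    moreover have "f u = f v" "u \<in> pverts G" "v \<in> pverts G"
      using that by (auto simp: P_def cls_def)
    ultimately show False
      using f \<open>u \<noteq> v\<close> by (auto simp: nl_function_def inj_on_def location_def)
  qed
  with part indep have "nl_coloring G P"
    unfolding nl_coloring_def coloring_def
    by (intro conjI ballI impI)
  moreover have "card P = card (f ` pverts G)"
    using inj by (simp add: P_def card_image)
  ultimately show ?thesis by blast
qed

text \<open>Each vertex is colored by the part that contains it, so the parts themselves serve as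
  colors.\<close>

lemma nl_function_of_coloring:
  assumes G: "pair_graph G" and P: "nl_coloring G P"
  shows "\<exists>f. nl_function G f \<and> f ` pverts G = P"
proof -
  interpret pair_graph G by fact
  have part: "partition_on (pverts G) P"
    using P by (simp add: nl_coloring_def coloring_def)
  define f where "f v = (THE S. S \<in> P \<and> v \<in> S)" for v
  have f: "f v = S" if "S \<in> P" "v \<in> S" for v S
    unfolding f_def using that part
    by (intro the_equality) (auto simp: partition_on_def disjoint_def)
  have fP: "f v \<in> P \<and> v \<in> f v" if v: "v \<in> pverts G" for v
  proof -
    obtain S where "S \<in> P" "v \<in> S"
      using v part by (metis UnionE partition_onD1)
    with f show ?thesis by simp
  qed
  have im: "f ` pverts G = P"
  proof
    show "P \<subseteq> f ` pverts G"
    proof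
      fix S assume "S \<in> P"
      moreover have "S \<noteq> {}" "S \<subseteq> pverts G"
        using \<open>S \<in> P\<close> part by (auto simp: partition_on_def)
      ultimately obtain v where "v \<in> S" "v \<in> pverts G"
        by blast
      with f[OF \<open>S \<in> P\<close>] show "S \<in> f ` pverts G" by blast
    qed
  qed (use fP in blast)
  have nb: "{T \<in> P. nbhd G u \<inter> T \<noteq> {}} = f ` nbhd G u" for u
  proof (intro equalityI subsetI)
    fix T assume "T \<in> f ` nbhd G u"
    then obtain w where w: "w \<in> nbhd G u" "T = f w"
      by blast
    then have "w \<in> pverts G"
      by (auto simp: nbhd_def dest: wellformed)
    with fP w show "T \<in> {T \<in> P. nbhd G u \<inter> T \<noteq> {}}"
      by blast
  next
    fix T assume "T \<in> {T \<in> P. nbhd G u \<inter> T \<noteq> {}}"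
    then obtain w where "T \<in> P" "w \<in> nbhd G u" "w \<in> T"
      by blast
    with f show "T \<in> f ` nbhd G u"
      by blast
  qed
  have proper: "f u \<noteq> f v" if "(u, v) \<in> parcs G" for u v
    using that fP[of u] fP[of v] wellformed[OF that] P
    by (auto simp: nl_coloring_def coloring_def independent_set_def)
  have "inj_on (location G f) (pverts G)"
  proof (rule inj_onI, rule ccontr)
    fix u v assume uv: "u \<in> pverts G" "v \<in> pverts G" "location G f u = location G f v" "u \<noteq> v"
    then have "f u = f v" "f ` nbhd G u = f ` nbhd G v"
      using location_eq_iff[of G f u v] proper by auto
    with uv fP[of u] fP[of v] P show False
      unfolding nl_coloring_def nb by metis
  qed
  with proper im show ?thesis
    by (auto simp: nl_function_def)
qed

text \<open>The lower bound only has to treat colors of type \<open>'a set\<close>, because the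
  functions obtained from colorings take parts as values.\<close>

lemma chi_NL_eqI:
  assumes G: "pair_graph G"
    and f: "nl_function G f" "card (f ` pverts G) \<le> k"
    and lower: "\<And>g :: 'a \<Rightarrow> 'a set. nl_function G g \<Longrightarrow> k \<le> card (g ` pverts G)"
  shows "chi_NL (G :: 'a pair_pre_digraph) = k"
proof -
  have low: "k \<le> card P" if "nl_coloring G P" for P
    using nl_function_of_coloring[OF G that] lower by blast
  obtain P where P: "nl_coloring G P" "card P = card (f ` pverts G)"
    using nl_coloring_of_function[OF G f(1)] by blast
  with low f(2) have "card P = k"
    by (metis le_antisym)
  with P(1) low show ?thesis
    unfolding chi_NL_def by (intro Least_equality) auto
qed

section \<open>Color sequences\<close>

text \<open>Only interior positions are listed: the neighbors of the two ends depend on whether the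
  sequence is read as a path or as a cycle.\<close>

fun inner_locations :: "'c list \<Rightarrow> ('c \<times> 'c set) list" where
  "inner_locations (x # y # z # r) = (y, {x, y, z}) # inner_locations (y # z # r)"
| "inner_locations _ = []"

lemma length_inner_locations [simp]: "length (inner_locations v) = length v - 2"
  by (induction v rule: inner_locations.induct) auto

lemma nth_inner_locations:
  "i + 2 < length v \<Longrightarrow> inner_locations v ! i = (v ! (i + 1), {v ! i, v ! (i + 1), v ! (i + 2)})"
  by (induction v arbitrary: i rule: inner_locations.induct) (auto simp: nth_Cons split: nat.splits)

text \<open>The two pieces overlap in \<open>a b\<close>, so every window of three consecutive
  colors lies in exactly one of them.\<close>

lemma inner_locations_append:
  "inner_locations (p @ a # b # q) = inner_locations (p @ [a, b]) @ inner_locations (a # b # q)"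
proof (induction p)
  case (Cons x p)
  then show ?case
    by (cases p; cases "tl p") auto
qed simp

text \<open>These are the places where a block can be inserted. The pairs are unordered because the
  insertion works for either order of the two colors.\<close>

fun adjacencies :: "'c list \<Rightarrow> 'c set set" where
  "adjacencies (x # y # r) = insert {x, y} (adjacencies (y # r))"
| "adjacencies _ = {}"

lemma adjacencies_append:
  "adjacencies (p @ a # q) = adjacencies (p @ [a]) \<union> adjacencies (a # q)"
proof (induction p)
  case (Cons x p)
  then show ?case
    by (cases p) auto
qed simp

lemma adjacenciesE:
  assumes "e \<in> adjacencies v"
  obtains p a b q where "v = p @ a # b # q" "e = {a, b}"
proof -
  have "\<exists>p a b q. v = p @ a # b # q \<and> e = {a, b}"
    using assms
  proof (induction v rule: adjacencies.induct)
    case (1 x y r)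
    show ?case
    proof (cases "e = {x, y}")
      case True
      then show ?thesis
        by (intro exI[of _ "[]"]) auto
    next
      case False
      with 1 obtain p a b q where "y # r = p @ a # b # q" "e = {a, b}"
        by auto
      then show ?thesis
        by (intro exI[of _ "x # p"]) auto
    qed
  qed auto
  with that show thesis by blast
qed

text \<open>Applied to the two- and three-element subsets of a color set, this is the set of all
  conceivable locations.\<close>

definition pointed :: "'c set set \<Rightarrow> ('c \<times> 'c set) set" where
  "pointed F = {(x, B). B \<in> F \<and> x \<in> B}"

lemma pointed_Un: "pointed (F \<union> G) = pointed F \<union> pointed G"
  and pointed_Int: "pointed (F \<inter> G) = pointed F \<inter> pointed G"
  and pointed_empty [simp]: "pointed {} = {}"
  by (auto simp: pointed_def)

lemma pointed_mono: "F \<subseteq> G \<Longrightarrow> pointed F \<subseteq> pointed G"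
  by (auto simp: pointed_def)

lemma pointed_eq_Sigma: "pointed F = prod.swap ` Sigma F id"
  by (auto simp: pointed_def image_iff)

lemma card_pointed:
  assumes "finite F" "\<And>B. B \<in> F \<Longrightarrow> finite B"
  shows "card (pointed F) = (\<Sum>B\<in>F. card B)"
  using assms by (simp add: pointed_eq_Sigma card_image)

lemma finite_pointed: "finite F \<Longrightarrow> (\<And>B. B \<in> F \<Longrightarrow> finite B) \<Longrightarrow> finite (pointed F)"
  by (simp add: pointed_eq_Sigma)

text \<open>The parameters \<open>x y\<close> and \<open>s t\<close> are the first two and the last two colors of the sequence; inserting
  a block never changes them, whence the locations of the two end vertices are fixed as well.\<close>

definition realizes :: "'c \<Rightarrow> 'c \<Rightarrow> 'c \<Rightarrow> 'c \<Rightarrow> ('c \<times> 'c set) set \<Rightarrow> 'c set set \<Rightarrow> bool" where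
  "realizes x y s t U A \<longleftrightarrow> (\<exists>v. take 2 v = [x, y] \<and> take 2 (rev v) = [t, s] \<and> distinct_adj v
     \<and> distinct (inner_locations v) \<and> set (inner_locations v) = U \<and> A \<subseteq> adjacencies v)"

lemma realizes_mono: "realizes x y s t U A \<Longrightarrow> A' \<subseteq> A \<Longrightarrow> realizes x y s t U A'"
  by (auto simp: realizes_def)

lemma take_2_append_cong: "take 2 (p @ a # b # q) = take 2 (p @ a # b # q')"
  by (cases p; cases "tl p") (auto simp: numeral_2_eq_2)

text \<open>All pairs inside \<open>B\<close> are recorded as adjacencies because later blocks may
  be anchored at them.\<close>

lemma realizes_insert_block:
  assumes "realizes x y s t U A" "e \<in> A" "e \<subseteq> B" "card B = 2 \<or> card B = 3"
    and disj: "pointed {B} \<inter> U = {}"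
  shows "realizes x y s t (U \<union> pointed {B}) (A \<union> nsets B 2)"
proof -
  obtain v where v: "take 2 v = [x, y]" "take 2 (rev v) = [t, s]" "distinct_adj v"
    "distinct (inner_locations v)" "set (inner_locations v) = U" "A \<subseteq> adjacencies v"
    using assms(1) by (auto simp: realizes_def)
  then obtain p a b q where pq: "v = p @ a # b # q" and e: "e = {a, b}"
    using assms(2) adjacenciesE by blast
  have ab: "a \<noteq> b"
    using v(3) by (auto simp: pq distinct_adj_append_iff)
  have fin: "finite B"
    using assms(4) by (metis card.infinite zero_neq_numeral)
  have "card (B - {a, b}) = card B - 2"
    using assms(3) e ab fin by (simp add: card_Diff_subset)
  with assms(4) have "card (B - {a, b}) = 0 \<or> card (B - {a, b}) = 1"
    by auto
  \<comment> \<open>\<open>m\<close> lists the colors of \<open>B\<close> other than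
    \<open>a\<close> and \<open>b\<close>; there is at most one.\<close>
  then have "\<exists>m. B = {a, b} \<union> set m \<and> distinct m \<and> a \<notin> set m \<and> b \<notin> set m \<and> (m = [] \<or> (\<exists>c. m = [c]))"
  proof
    assume "card (B - {a, b}) = 0"
    then have "B = {a, b}"
      using fin e assms(3) by auto
    then show ?thesis
      by (intro exI[of _ "[]"]) auto
  next
    assume "card (B - {a, b}) = 1"
    then obtain c where "B - {a, b} = {c}"
      using card_1_singletonE by blast
    then show ?thesis
      using e assms(3) by (intro exI[of _ "[c]"]) auto
  qed
  then obtain m where m: "B = {a, b} \<union> set m" "distinct m" "a \<notin> set m" "b \<notin> set m"
    "m = [] \<or> (\<exists>c. m = [c])"
    by blast
  define w where "w = p @ a # b # m @ a # b # q"
  \<comment> \<open>Any three consecutive colors of \<open>a b m a b\<close> make up exactly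
    \<open>B\<close>, and the middle colors run through \<open>b\<close>, \<open>m\<close>,
    \<open>a\<close>, hence through each element of \<open>B\<close> once.\<close>
  have il: "inner_locations w
      = inner_locations (p @ [a, b]) @ map (\<lambda>x. (x, B)) (b # m @ [a]) @ inner_locations (a # b # q)"
    unfolding w_def inner_locations_append[of p a b "m @ a # b # q"] using m(1,5) by auto
  have iv: "inner_locations v = inner_locations (p @ [a, b]) @ inner_locations (a # b # q)"
    unfolding pq by (rule inner_locations_append)
  have new: "set (map (\<lambda>x. (x, B)) (b # m @ [a])) = pointed {B}"
    using m(1) by (auto simp: pointed_def)
  have "take 2 w = [x, y]"
    using v(1) take_2_append_cong[of p a b] unfolding w_def pq by metis
  moreover have "take 2 (rev w) = [t, s]"
    using v(2) take_2_append_cong[of "rev q" b a "rev p"] unfolding w_def pq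
    by (simp add: take_2_append_cong[of "rev q" b a _ "rev p"])
  moreover have "distinct_adj w"
    using v(3) m ab by (auto simp: w_def pq distinct_adj_append_iff)
  moreover have "distinct (inner_locations w)"
  proof -
    have "distinct (map (\<lambda>x. (x, B)) (b # m @ [a]))"
      using m ab by (auto simp: distinct_map inj_on_def)
    moreover have "set (inner_locations (p @ [a, b])) \<subseteq> U" "set (inner_locations (a # b # q)) \<subseteq> U"
      using v(5) by (auto simp: iv)
    ultimately show ?thesis
      using v(4) disj new unfolding il iv distinct_append set_append by blast
  qed
  moreover have "set (inner_locations w) = U \<union> pointed {B}"
    using v(5) new unfolding il iv set_append by blast
  moreover have "A \<union> nsets B 2 \<subseteq> adjacencies w"
  proof -
    have "adjacencies v \<subseteq> adjacencies w"
      unfolding pq w_def adjacencies_append[of p a "b # q"]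
        adjacencies_append[of p a "b # m @ a # b # q"]
      using adjacencies_append[of "a # b # m" a "b # q"] by auto
    moreover have "nsets B 2 \<subseteq> adjacencies w"
      unfolding w_def adjacencies_append[of p a "b # m @ a # b # q"]
      using m by (auto simp: nsets_2_eq insert_commute)
    ultimately show ?thesis
      using v(6) by blast
  qed
  ultimately show ?thesis
    unfolding realizes_def by (intro exI[of _ w] conjI)
qed

text \<open>Every block is anchored at a pair of the initial set \<open>A\<close>, and insertions
  never destroy adjacencies, so the blocks can be inserted one after another in any order.\<close>

lemma realizes_blocks:
  assumes "finite G" "realizes x y s t U A"
    and "\<And>B. B \<in> G \<Longrightarrow> (card B = 2 \<or> card B = 3) \<and> (\<exists>e\<in>A. e \<subseteq> B)"
    and "pointed G \<inter> U = {}"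
  shows "realizes x y s t (U \<union> pointed G) (A \<union> (\<Union>B\<in>G. nsets B 2))"
  using assms
proof (induction G rule: finite_induct)
  case (insert B G)
  have split: "pointed (insert B G) = pointed G \<union> pointed {B}"
    by (auto simp: pointed_def)
  have "realizes x y s t (U \<union> pointed G) (A \<union> (\<Union>B\<in>G. nsets B 2))"
  proof (rule insert.IH)
    show "pointed G \<inter> U = {}"
      using insert.prems(3) unfolding split by blast
  qed (simp_all add: insert.prems)
  moreover obtain e where e: "e \<in> A" "e \<subseteq> B"
    using insert.prems(2)[of B] by blast
  moreover have "pointed {B} \<inter> pointed G = {}"
    using insert.hyps(2) by (auto simp: pointed_def)
  then have "pointed {B} \<inter> (U \<union> pointed G) = {}"
    using insert.prems(3) unfolding split by blast
  ultimately have "realizes x y s t (U \<union> pointed G \<union> pointed {B})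
      (A \<union> (\<Union>B\<in>G. nsets B 2) \<union> nsets B 2)"
    using insert.prems(2)[of B] by (intro realizes_insert_block[of _ _ _ _ _ _ e]) simp_all
  then show ?case
    unfolding split by (simp add: Un_ac)
qed simp

section \<open>Inserting all triples, one new color at a time\<close>

lemma nsets_insert:
  assumes "x \<notin> A"
  shows "nsets (insert x A) (Suc k) = nsets A (Suc k) \<union> insert x ` nsets A k"
proof (intro equalityI subsetI)
  fix B assume B: "B \<in> nsets (insert x A) (Suc k)"
  show "B \<in> nsets A (Suc k) \<union> insert x ` nsets A k"
  proof (cases "x \<in> B")
    case True
    then have "B = insert x (B - {x})" "B - {x} \<in> nsets A k"
      using B by (auto simp: nsets_def)
    then show ?thesis by blast
  qed (use B in \<open>auto simp: nsets_def\<close>)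
qed (use assms in \<open>auto simp: nsets_def card_insert_if\<close>)

lemma nsets_lessThan_Suc_3:
  fixes m :: nat
  shows
  "nsets {..<Suc m} 3 = nsets {..<m} 3 \<union> insert m ` nsets {..<m} 2"
  using nsets_insert[of m "{..<m}" 2] by (simp add: lessThan_Suc numeral_3_eq_3 numeral_2_eq_2)

lemma nsets_lessThan_Suc_2:
  fixes m :: nat
  shows "nsets {..<Suc m} 2 = nsets {..<m} 2 \<union> (\<lambda>a. {a, m}) ` {..<m}"
  using nsets_insert[of m "{..<m}" 1]
  by (simp add: lessThan_Suc numeral_2_eq_2 nsets_one image_image insert_commute)

text \<open>Once all pairs below \<open>m\<close> are adjacencies, each of them can be extended by
  \<open>m\<close> to a triple and inserted; these triples in turn make all pairs with
  \<open>m\<close> adjacencies. The triple \<open>{..<3}\<close> is exempt because the two starting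
  sequences treat it differently.\<close>

lemma realizes_triples:
  fixes m :: nat
  assumes "3 \<le> m" "realizes x y s t U (nsets {..<3} 2)"
    and "pointed (nsets {..<m} 3 - {{..<3}}) \<inter> U = {}"
  shows "realizes x y s t (U \<union> pointed (nsets {..<m} 3 - {{..<3}})) (nsets {..<m} 2)"
  using assms(1,3)
proof (induction m rule: nat_induct_at_least)
  case base
  then show ?case
    using assms(2) by simp
next
  case (Suc m)
  let ?G = "insert m ` nsets {..<m} 2"
  let ?F = "nsets {..<m} 3 - {{..<3::nat}}"
  have G: "card B = 3 \<and> m \<in> B" if "B \<in> ?G" for B
    using that by (auto simp: nsets_def card_insert_if)
  have split: "nsets {..<Suc m} 3 - {{..<3}} = ?F \<union> ?G"
  proof -
    have "{..<3} \<notin> ?G"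
      using G[of "{..<3}"] Suc.hyps by auto
    then show ?thesis
      unfolding nsets_lessThan_Suc_3 by blast
  qed
  have "m \<notin> B" if "B \<in> ?F" for B
    using that by (auto simp: nsets_def)
  with G have "?F \<inter> ?G = {}"
    by blast
  then have "pointed ?G \<inter> (U \<union> pointed ?F) = {}"
    using Suc.prems pointed_Int[of ?F ?G] unfolding split pointed_Un by auto
  moreover have "realizes x y s t (U \<union> pointed ?F) (nsets {..<m} 2)"
    using Suc.IH Suc.prems unfolding split pointed_Un by blast
  ultimately have "realizes x y s t (U \<union> pointed ?F \<union> pointed ?G)
      (nsets {..<m} 2 \<union> (\<Union>B\<in>?G. nsets B 2))"
    using G by (intro realizes_blocks) (auto simp: finite_imp_finite_nsets)
  moreover have "nsets {..<Suc m} 2 \<subseteq> nsets {..<m} 2 \<union> (\<Union>B\<in>?G. nsets B 2)"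
  proof
    fix e assume e: "e \<in> nsets {..<Suc m} 2"
    consider "e \<in> nsets {..<m} 2" | a where "a < m" "e = {a, m}"
      using e unfolding nsets_lessThan_Suc_2 by blast
    then show "e \<in> nsets {..<m} 2 \<union> (\<Union>B\<in>?G. nsets B 2)"
    proof cases
      case 2
      \<comment> \<open>Any second color below \<open>m\<close> would do: the triple of
        \<open>a\<close>, \<open>b\<close>, \<open>m\<close> has been inserted and contains
        \<open>e\<close>.\<close>
      define b where "b = (if a = 0 then 1 else 0 :: nat)"
      have "{a, b} \<in> nsets {..<m} 2"
        using 2 Suc.hyps by (auto simp: b_def)
      moreover have "e \<in> nsets (insert m {a, b}) 2"
        using 2 by auto
      ultimately show ?thesis by blast
    qed blast
  qed
  ultimately have "realizes x y s t (U \<union> pointed ?F \<union> pointed ?G) (nsets {..<Suc m} 2)"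
    by (rule realizes_mono)
  then show ?case
    unfolding split pointed_Un Un_assoc .
qed

section \<open>Counting locations\<close>

abbreviation blocks :: "'c set \<Rightarrow> 'c set set" where
  "blocks K \<equiv> nsets K 2 \<union> nsets K 3"

lemma ell_eq_blocks: "ell m = 3 * (m choose 3) + 2 * (m choose 2)"
proof (cases "m \<ge> 2")
  case True
  have "3 * (m choose 3) = (m - 2) * (m choose 2)"
    using binomial_absorption[of 2 m] binomial_absorb_comp[of m 2] by (simp add: eval_nat_numeral)
  moreover obtain j where "m = j + 2"
    using True by (metis add.commute le_Suc_ex)
  ultimately show ?thesis
    by (simp add: ell_eq_choose algebra_simps)
next
  case False
  then have "m = 0 \<or> m = 1" by auto
  then show ?thesis by (auto simp: ell_eq_choose)
qed

text \<open>A new color forms a triple with each of the \<open>m choose 2\<close> old pairs and a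
  pair with each of the \<open>m\<close> old colors.\<close>

lemma ell_Suc: "ell (Suc m) = ell m + 3 * (m choose 2) + 2 * m"
proof -
  have "Suc m choose 3 = (m choose 2) + (m choose 3)" "Suc m choose 2 = m + (m choose 2)"
    by (simp_all add: numeral_3_eq_3 numeral_2_eq_2)
  then show ?thesis
    by (simp add: ell_eq_blocks)
qed

lemma ell_mono: "m \<le> m' \<Longrightarrow> ell m \<le> ell m'"
  by (simp add: lift_Suc_mono_le[of ell] ell_Suc)

lemma finite_blocks: "finite K \<Longrightarrow> finite (blocks K)"
  by (simp add: finite_imp_finite_nsets)

lemma sum_card_nsets: "F \<subseteq> nsets K k \<Longrightarrow> (\<Sum>B\<in>F. card B) = k * card F"
proof -
  assume "F \<subseteq> nsets K k"
  then have "(\<Sum>B\<in>F. card B) = (\<Sum>B\<in>F. k)"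
    by (intro sum.cong) (auto simp: nsets_def)
  then show ?thesis by simp
qed

lemma card_pointed_nsets:
  assumes "finite K" "F \<subseteq> nsets K k"
  shows "card (pointed F) = k * card F"
proof -
  have "finite F"
    using assms finite_subset finite_imp_finite_nsets by blast
  moreover have "finite B" if "B \<in> F" for B
    using that assms(2) by (auto simp: nsets_def)
  ultimately have "card (pointed F) = (\<Sum>B\<in>F. card B)"
    by (rule card_pointed)
  then show ?thesis
    using sum_card_nsets[OF assms(2)] by simp
qed

lemma finite_pointed_nsets:
  assumes "finite K" "F \<subseteq> blocks K"
  shows "finite (pointed F)"
proof (rule finite_pointed)
  show "finite F"
    using assms finite_subset finite_blocks by blast
  show "finite B" if "B \<in> F" for B
    using that assms(2) by (auto simp: nsets_def)
qed

lemma card_pointed_blocks: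
  assumes "finite K"
  shows "card (pointed (blocks K)) = ell (card K)"
proof -
  have "nsets K 2 \<inter> nsets K 3 = {}"
    by (auto simp: nsets_def)
  then have "pointed (nsets K 2) \<inter> pointed (nsets K 3) = {}"
    by (simp flip: pointed_Int)
  then have "card (pointed (blocks K)) = card (pointed (nsets K 2)) + card (pointed (nsets K 3))"
    unfolding pointed_Un using assms by (intro card_Un_disjoint) (auto intro: finite_pointed_nsets)
  then show ?thesis
    using assms card_pointed_nsets[of K "nsets K 2" 2] card_pointed_nsets[of K "nsets K 3" 3]
    by (simp add: ell_eq_blocks)
qed

text \<open>Here \<open>t\<close> counts the triples that contain the largest color, and \<open>d\<close> counts the pairs. A pair
  with the largest color is only available if at most one of the \<open>C\<close> triples is left out.\<close>

lemma triples_pairs_decomposition: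
  fixes C r x :: nat
  assumes "3 \<le> C" "2 * C \<le> x + 1" "x \<le> 5 * C + 2 * r" "x + 1 \<noteq> 5 * C + 2 * r"
  shows "\<exists>t d. x = 3 * t + 2 * d \<and> 1 \<le> d \<and> t \<le> C \<and> (d \<le> C \<or> C \<le> t + 1 \<and> d \<le> C + r)"
proof (cases "x + 3 \<le> 5 * C")
  case True
  show ?thesis
  proof (cases "x < 2 * C")
    case True
    \<comment> \<open>Here \<open>x = 2 * C - 1\<close>, which is one triple and
      \<open>C - 2\<close> pairs.\<close>
    then show ?thesis
      using assms by - (rule exI[of _ 1], rule exI[of _ "C - 2"], auto)
  next
    case False
    define y where "y = x - 2 * C"
    have y: "x = 2 * C + y" "y + 3 \<le> 3 * C"
      using False \<open>x + 3 \<le> 5 * C\<close> by (auto simp: y_def)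
    \<comment> \<open>Start from \<open>C\<close> pairs and add \<open>q\<close> triples; each unit
      of the remainder \<open>j\<close> is gained by exchanging a pair for a triple.\<close>
    define q j where "q = y div 3" and "j = y mod 3"
    have "y = 3 * q + j" "j < 3"
      by (simp_all add: q_def j_def)
    with y show ?thesis
      using assms(1) by - (rule exI[of _ "q + j"], rule exI[of _ "C - j"], auto)
  qed
next
  case False
  \<comment> \<open>For large \<open>x\<close> take \<open>t = C\<close> or
    \<open>t = C - 1\<close>, whichever leaves an even rest for the pairs.\<close>
  show ?thesis
  proof (cases "even (x + C)")
    case True
    define d where "d = (x - 3 * C) div 2"
    have "even (x - 3 * C)" using True False by auto
    then have "2 * d = x - 3 * C" by (simp add: d_def)
    then show ?thesis
      using False assms by - (rule exI[of _ C], rule exI[of _ d], auto)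
  next
    case odd: False
    define d where "d = (x - 3 * (C - 1)) div 2"
    have "even (x - 3 * (C - 1))" using odd False assms(1) by auto
    then have "2 * d = x - 3 * (C - 1)" by (simp add: d_def)
    \<comment> \<open>The bound \<open>d \<le> C + r\<close> requires
      \<open>x + 3 \<le> 5 * C + 2 * r\<close>. Of the three larger values allowed for
      \<open>x\<close>, parity removes two and the hypothesis removes the one between them.\<close>
    moreover have "x \<noteq> 5 * C + 2 * r"
      using odd by auto
    then have "x + 1 < 5 * C + 2 * r"
      using assms by linarith
    moreover have "x + 2 \<noteq> 5 * C + 2 * r"
      using odd by presburger
    ultimately show ?thesis
      using False assms by - (rule exI[of _ "C - 1"], rule exI[of _ d], auto)
  qed
qed

section \<open>Sequences of prescribed length\<close>

lemma three_le_choose_2: "3 \<le> m \<Longrightarrow> 3 \<le> m choose 2"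
  by (induction m rule: nat_induct_at_least) (simp_all add: numeral_2_eq_2 numeral_3_eq_3)

lemma realizes_two_ends:
  fixes m n :: nat
  assumes m: "3 \<le> m" and n: "ell m \<le> n + 1" "n \<le> ell (Suc m)" "n + 1 \<noteq> ell (Suc m)"
  shows "\<exists>U A. realizes 0 1 0 1 U A \<and> U \<subseteq> pointed (blocks {..<Suc m} - {{0, 1}}) \<and> card U + 2 = n"
proof -
  let ?T = "nsets {..<m} 3" and ?P = "nsets {..<m} 2"
  define C where "C = m choose 2"
  define x where "x = n - 3 * (m choose 3)"
  have C: "3 \<le> C"
    using three_le_choose_2[OF m] by (simp add: C_def)
  have x: "n = 3 * (m choose 3) + x" "2 * C \<le> x + 1" "x \<le> 5 * C + 2 * m" "x + 1 \<noteq> 5 * C + 2 * m"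
    using n C unfolding ell_Suc ell_eq_blocks[of m] x_def C_def by auto
  then obtain t d where td: "x = 3 * t + 2 * d" "1 \<le> d" "t \<le> C" "d \<le> C \<or> C \<le> t + 1 \<and> d \<le> C + m"
    using triples_pairs_decomposition[OF C x(2-4)] by blast

  \<comment> \<open>In the sequence \<open>0 1\<close> the prescribed beginning and end overlap
    completely and there are no inner positions. Inserting the first triple yields
    \<open>0 1 2 0 1\<close>.\<close>
  have "realizes 0 1 0 1 {} {{0, 1 :: nat}}"
    unfolding realizes_def by (rule exI[of _ "[0, 1]"]) auto
  then have "realizes 0 1 0 1 ({} \<union> pointed {{..<3}}) ({{0, 1 :: nat}} \<union> nsets {..<3} 2)"
    by (rule realizes_insert_block[where e = "{0, 1}"]) auto
  then have "realizes 0 1 0 1 (pointed {{..<3}}) (nsets {..<3 :: nat} 2)"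
    by (auto elim: realizes_mono)
  then have "realizes 0 1 0 1 (pointed {{..<3}} \<union> pointed (?T - {{..<3}})) ?P"
    by (intro realizes_triples m) (simp_all flip: pointed_Int)
  moreover have "{..<3} \<in> ?T"
    using m by (auto simp: nsets_def)
  then have "{{..<3}} \<union> (?T - {{..<3}}) = ?T"
    by blast
  ultimately have base: "realizes 0 1 0 1 (pointed ?T) ?P"
    by (simp flip: pointed_Un)

  have notin: "m \<notin> e" if "e \<in> ?P" for e
    using that by (auto simp: nsets_def)
  have inj: "inj_on (insert m) ?P"
    by (rule inj_onI) (simp add: notin insert_ident)
  then have "card (insert m ` ?P) = C"
    by (simp add: card_image C_def)
  with td(3) obtain T where T: "T \<subseteq> insert m ` ?P" "card T = t"
    by (metis obtain_subset_with_card_n)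
  have "finite (insert m ` ?P)"
    by (simp add: finite_imp_finite_nsets)
  with T have finT: "finite T"
    using finite_subset by blast
  have Tm: "m \<in> B \<and> card B = 3" if B: "B \<in> T" for B
  proof -
    obtain e where "e \<in> ?P" "B = insert m e"
      using B T(1) by blast
    then show ?thesis
      using notin[of e] by (simp add: nsets_def)
  qed
  have T3: "T \<subseteq> nsets {..<Suc m} 3"
    using T(1) unfolding nsets_lessThan_Suc_3 by blast
  have TT: "?T \<inter> T = {}"
  proof -
    have "m \<notin> B" if "B \<in> ?T" for B
      using that by (auto simp: nsets_def)
    with Tm show ?thesis by blast
  qed
  define A where "A = ?P \<union> (\<Union>B\<in>T. nsets B 2)"
  have "realizes 0 1 0 1 (pointed ?T \<union> pointed T) A"
    unfolding A_def
  proof (rule realizes_blocks[OF finT base])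
    show "pointed T \<inter> pointed ?T = {}"
      using TT by (simp add: Int_commute flip: pointed_Int)
    show "(card B = 2 \<or> card B = 3) \<and> (\<exists>e\<in>?P. e \<subseteq> B)" if "B \<in> T" for B
      using Tm[OF that] T(1) that by blast
  qed
  then have R: "realizes 0 1 0 1 (pointed (?T \<union> T)) A"
    by (simp add: pointed_Un)

  \<comment> \<open>At least \<open>d\<close> insertable pairs are wanted. The \<open>C\<close> old
    pairs suffice unless \<open>d > C\<close>; in that case at most one triple with \<open>m\<close>
    is missing, and all pairs with \<open>m\<close> are adjacencies too.\<close>
  have "\<exists>E \<subseteq> nsets {..<Suc m} 2. E \<subseteq> A \<and> {0, 1} \<in> E \<and> d \<le> card E"
  proof (cases "d \<le> C")
    case True
    then show ?thesis
      using m unfolding nsets_lessThan_Suc_2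
      by (intro exI[of _ ?P]) (simp add: A_def C_def)
  next
    case False
    have "{a, m} \<in> A" if a: "a < m" for a
    proof -
      \<comment> \<open>\<open>b\<close> and \<open>c\<close> give two different pairs containing
        \<open>a\<close>; as \<open>T\<close> omits at most one triple, it contains the extension by
        \<open>m\<close> of one of them.\<close>
      define b c where "b = (if a = 0 then 1 else 0 :: nat)" and "c = (if a = 2 then 1 else 2 :: nat)"
      have bc: "{a, b} \<in> ?P" "{a, c} \<in> ?P" "{a, b} \<noteq> {a, c}"
        using a m by (auto simp: b_def c_def doubleton_eq_iff)
      have "insert m {a, b} \<in> T \<or> insert m {a, c} \<in> T"
      proof (rule ccontr)
        assume "\<not> ?thesis"
        then have "T \<subseteq> insert m ` (?P - {{a, b}, {a, c}})"
          using T(1) by auto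
        then have "card T \<le> card (?P - {{a, b}, {a, c}})"
          using surj_card_le[of "?P - {{a, b}, {a, c}}" T "insert m"] by (simp add: finite_imp_finite_nsets)
        also have "\<dots> = C - 2"
          using bc by (simp add: card_Diff_subset C_def)
        finally have "t \<le> C - 2"
          using T(2) by simp
        moreover have "C \<le> t + 1"
          using td(4) False by simp
        ultimately show False
          using C by linarith
      qed
      then obtain e where "insert m {a, e} \<in> T"
        by blast
      moreover have "{a, m} \<in> nsets (insert m {a, e}) 2"
        using a by simp
      ultimately show ?thesis
        unfolding A_def by (intro UnI2 UN_I)
    qed
    then have "nsets {..<Suc m} 2 \<subseteq> A"
      unfolding nsets_lessThan_Suc_2 by (auto simp: A_def)
    moreover have "Suc m choose 2 = m + C"
      unfolding C_def by (simp add: numeral_2_eq_2)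
    then have "d \<le> card (nsets {..<Suc m} 2)"
      using td(4) False by simp
    moreover have "{0, 1} \<in> nsets {..<Suc m} 2"
      using m by simp
    ultimately show ?thesis
      by blast
  qed
  then obtain E where E: "E \<subseteq> nsets {..<Suc m} 2" "E \<subseteq> A" "{0, 1} \<in> E" "d \<le> card E"
    by blast
  \<comment> \<open>The pair \<open>{0, 1}\<close> is counted in \<open>d\<close> but not
    inserted.\<close>
  have "d - 1 \<le> card (E - {{0, 1}})"
    using E by simp
  then obtain D where D: "D \<subseteq> E - {{0, 1}}" "card D = d - 1"
    by (metis obtain_subset_with_card_n)
  have D2: "D \<subseteq> nsets {..<Suc m} 2"
    using D E by blast
  then have finD: "finite D"
    by (rule finite_subset) (simp add: finite_imp_finite_nsets)
  have cardD: "card B = 2" if "B \<in> D" for B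
    using that D2 by (auto simp: nsets_def)
  have card3: "card B = 3" if "B \<in> ?T \<union> T" for B
    using that Tm by (auto simp: nsets_def)
  have disj: "D \<inter> (?T \<union> T) = {}"
  proof (rule ccontr)
    assume "\<not> ?thesis"
    then obtain B where "B \<in> D" "B \<in> ?T \<union> T"
      by blast
    with cardD[of B] card3[of B] show False
      by simp
  qed
  have "realizes 0 1 0 1 (pointed (?T \<union> T) \<union> pointed D) (A \<union> (\<Union>B\<in>D. nsets B 2))"
  proof (rule realizes_blocks[OF finD R])
    show "pointed D \<inter> pointed (?T \<union> T) = {}"
      using disj by (simp flip: pointed_Int)
    show "(card B = 2 \<or> card B = 3) \<and> (\<exists>e\<in>A. e \<subseteq> B)" if "B \<in> D" for B
      using cardD[OF that] D(1) E(2) that by blast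
  qed
  moreover have "pointed (?T \<union> T) \<union> pointed D \<subseteq> pointed (blocks {..<Suc m} - {{0, 1}})"
  proof -
    have "?T \<union> T \<union> D \<subseteq> blocks {..<Suc m}"
      using T3 D2 nsets_lessThan_Suc_3[of m] by blast
    moreover have "{0, 1} \<notin> ?T \<union> T \<union> D"
      using D card3[of "{0, 1}"] by auto
    ultimately show ?thesis
      by (simp flip: pointed_Un add: pointed_mono subset_Diff_insert)
  qed
  moreover have "card (pointed (?T \<union> T) \<union> pointed D) + 2 = n"
  proof -
    have "?T \<union> T \<subseteq> nsets {..<Suc m} 3"
      using T3 nsets_lessThan_Suc_3[of m] by blast
    then have "card (pointed (?T \<union> T)) = 3 * card (?T \<union> T)" "finite (pointed (?T \<union> T))"
      by (auto intro: card_pointed_nsets finite_pointed_nsets)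
    moreover have "card (?T \<union> T) = (m choose 3) + t"
      using TT T(2) finT by (simp add: card_Un_disjoint finite_imp_finite_nsets)
    moreover have "card (pointed D) = 2 * (d - 1)" "finite (pointed D)"
      using card_pointed_nsets[OF _ D2] D(2) D2 by (auto intro: finite_pointed_nsets)
    moreover have "pointed (?T \<union> T) \<inter> pointed D = {}"
      using disj by (simp add: Int_commute flip: pointed_Int)
    ultimately show ?thesis
      using td x(1) by (simp add: card_Un_disjoint)
  qed
  ultimately show ?thesis
    by blast
qed

text \<open>The starting sequence \<open>0 1 0 2 1 2\<close> provides, together with its ends, all
  locations of \<open>{0, 1}\<close> and \<open>{1, 2}\<close> but omits \<open>(1, {..<3})\<close>.
  After all other blocks are inserted, this is the only missing location; the summand 3 accounts for
  it and the two ends.\<close>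

lemma realizes_all_but_one:
  fixes k :: nat
  assumes k: "3 \<le> k"
  shows "\<exists>U A. realizes 0 1 1 2 U A \<and> U \<subseteq> pointed (blocks {..<k}) - {(0, {0, 1}), (2, {1, 2})}
    \<and> card U + 3 = ell k"
proof -
  define U where "U = {(1 :: nat, {0, 1}), (0, {..<3}), (2, {..<3}), (1, {1, 2 :: nat})}"
  let ?T = "nsets {..<k} 3 - {{..<3}}" and ?D = "nsets {..<k} 2 - {{0, 1}, {1, 2}}"
  have three: "{..<3} = {0, 1, 2 :: nat}"
    by auto
  have "realizes 0 1 1 2 U (nsets {..<3} 2)"
    unfolding realizes_def
  proof (rule exI[of _ "[0, 1, 0, 2, 1, 2]"], intro conjI)
    show "nsets {..<3} 2 \<subseteq> adjacencies [0, 1, 0, 2, 1, 2 :: nat]"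
      unfolding three nsets_2_eq by auto
    show "distinct (inner_locations [0, 1, 0, 2, 1, 2 :: nat])"
      by (simp add: doubleton_eq_iff insert_commute)
    show "set (inner_locations [0, 1, 0, 2, 1, 2]) = U"
      unfolding U_def three by (simp add: insert_commute)
  qed simp_all
  moreover have UT: "pointed ?T \<inter> U = {}"
  proof -
    have "{0, 1} \<notin> ?T" "{1, 2} \<notin> ?T"
      by (auto simp: nsets_def)
    then show ?thesis
      by (auto simp: U_def pointed_def)
  qed
  ultimately have R: "realizes 0 1 1 2 (U \<union> pointed ?T) (nsets {..<k} 2)"
    by (rule realizes_triples[OF k])
  have TD: "?T \<inter> ?D = {}"
  proof -
    have "card B = 3" if "B \<in> ?T" for B
      using that by (simp add: nsets_def)
    moreover have "card B = 2" if "B \<in> ?D" for B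
      using that by (simp add: nsets_def)
    ultimately show ?thesis
      by (metis disjoint_iff numeral_eq_iff semiring_norm(88))
  qed
  have UD: "pointed ?D \<inter> U = {}"
  proof -
    have "{..<3} \<notin> ?D"
      by (auto simp: nsets_def)
    then show ?thesis
      by (auto simp: U_def pointed_def)
  qed
  have "realizes 0 1 1 2 (U \<union> pointed ?T \<union> pointed ?D)
      (nsets {..<k} 2 \<union> (\<Union>B\<in>?D. nsets B 2))"
  proof (rule realizes_blocks[OF _ R])
    show "pointed ?D \<inter> (U \<union> pointed ?T) = {}"
      using UD TD pointed_Int[of ?T ?D] by auto
    show "(card B = 2 \<or> card B = 3) \<and> (\<exists>e\<in>nsets {..<k} 2. e \<subseteq> B)" if "B \<in> ?D" for B
      using that by (simp add: nsets_def) blast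
  qed (simp add: finite_imp_finite_nsets)
  moreover have mem: "{0, 1} \<in> nsets {..<k} 2" "{1, 2} \<in> nsets {..<k} 2" "{..<3} \<in> nsets {..<k} 3"
    using k by (auto simp: nsets_def)
  have "U \<union> pointed ?T \<union> pointed ?D \<subseteq> pointed (blocks {..<k}) - {(0, {0, 1}), (2, {1, 2})}"
  proof -
    have "U \<subseteq> pointed (blocks {..<k})"
      using mem by (auto simp: U_def pointed_def)
    moreover have "pointed ?T \<union> pointed ?D \<subseteq> pointed (blocks {..<k})"
      by (auto simp: pointed_def)
    moreover have "2 \<in> {..<3 :: nat}" "2 \<notin> {0, 1 :: nat}" "0 \<in> {..<3 :: nat}" "0 \<notin> {1, 2 :: nat}"
      by simp_all
    then have "{0, 1} \<noteq> {..<3 :: nat}" "{1, 2} \<noteq> {..<3 :: nat}"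
      by metis+
    then have "(0, {0, 1}) \<notin> U" "(2, {1, 2}) \<notin> U"
      by (simp_all add: U_def)
    moreover have "(0, {0, 1}) \<notin> pointed ?T \<union> pointed ?D" "(2, {1, 2}) \<notin> pointed ?T \<union> pointed ?D"
      by (simp_all add: pointed_def nsets_def)
    ultimately show ?thesis
      by blast
  qed
  moreover have "card (U \<union> pointed ?T \<union> pointed ?D) + 3 = ell k"
  proof -
    have "card U = 4" "finite U"
      by (simp_all add: U_def doubleton_eq_iff)
    moreover have "card (pointed ?T) = 3 * ((k choose 3) - 1)" "finite (pointed ?T)"
      using card_pointed_nsets[of "{..<k}" ?T 3] mem by (auto intro: finite_pointed_nsets)
    moreover have "card {{0, 1}, {1, 2 :: nat}} = 2"
      by (simp add: doubleton_eq_iff insert_commute)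
    then have "card (pointed ?D) = 2 * ((k choose 2) - 2)" "finite (pointed ?D)"
      using card_pointed_nsets[of "{..<k}" ?D 2] mem
      by (auto simp: card_Diff_subset intro: finite_pointed_nsets)
    moreover have "U \<inter> pointed ?T = {}" "(U \<union> pointed ?T) \<inter> pointed ?D = {}"
      using UT UD TD pointed_Int[of ?T ?D] by auto
    moreover have "3 \<le> k choose 2" "1 \<le> k choose 3"
      using k three_le_choose_2 by (auto simp: Suc_le_eq)
    ultimately show ?thesis
      by (simp add: card_Un_disjoint ell_eq_blocks)
  qed
  ultimately show ?thesis
    by blast
qed

section \<open>Paths and cycles\<close>

lemma nbhd_path_graph:
  "i < n \<Longrightarrow> nbhd (path_graph n) i = {j. j < n \<and> (j = i + 1 \<or> i = j + 1)}"
  by (auto simp: nbhd_def path_graph_def)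

lemma nbhd_cycle_graph:
  assumes "3 \<le> n" "i < n"
  shows "nbhd (cycle_graph n) i = {(i + 1) mod n, (i + (n - 1)) mod n}"
proof -
  have "i = (j + 1) mod n \<longleftrightarrow> j = (i + (n - 1)) mod n" if "j < n" for j
    using that assms by (cases "i = 0") (auto simp: mod_Suc mod_if)
  then show ?thesis
    using assms by (auto simp: nbhd_def cycle_graph_def)
qed

text \<open>On a path each end has a single neighbor, which gives the two locations required to be
  outside \<open>U\<close>. If \<open>(x, y) = (s, t)\<close>, closing up the sequence gives each
  end a second neighbor of the same color as its first, so no location changes.\<close>

lemma nl_function_of_realization:
  assumes R: "realizes x y s t U A" and ends: "(x, {x, y}) \<notin> U" "(t, {s, t}) \<notin> U" "(x, {x, y}) \<noteq> (t, {s, t})"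
    and K: "U \<subseteq> pointed (blocks K)" "x \<in> K" "t \<in> K" and n: "card U + 2 = n"
  shows "\<exists>f. nl_function (path_graph n) f \<and> f ` {..<n} \<subseteq> K
    \<and> (3 \<le> n \<longrightarrow> (x, y) = (s, t) \<longrightarrow> nl_function (cycle_graph n) f)"
proof -
  obtain v where v: "take 2 v = [x, y]" "take 2 (rev v) = [t, s]" "distinct_adj v"
    "distinct (inner_locations v)" "set (inner_locations v) = U"
    using R by (auto simp: realizes_def)
  have len2: "2 \<le> length v"
    using arg_cong[OF v(1), of length] by simp
  then have len: "length v = n"
    using distinct_card[OF v(4)] v(5) n by simp
  have ni: "v ! i = take 2 v ! i" if "i < 2" for i
    using that by simp
  have nr: "v ! (n - Suc i) = take 2 (rev v) ! i" if "i < 2" for i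
    using that len2 by (simp add: rev_nth len)
  have nth: "v ! 0 = x" "v ! 1 = y" "v ! (n - 1) = t" "v ! (n - 2) = s"
    using ni[of 0] ni[of 1] nr[of 0] nr[of 1] unfolding v by (simp_all add: numeral_2_eq_2)
  \<comment> \<open>\<open>L\<close> lists the locations of all vertices of the path in order, ends
    included.\<close>
  define L where "L = (x, {x, y}) # inner_locations v @ [(t, {s, t})]"
  have distL: "distinct L"
    using ends v(4,5) by (simp add: L_def)
  have lenL: "length L = n"
    using len len2 by (simp add: L_def)
  have loc: "location (path_graph n) ((!) v) i = L ! i" if i: "i < n" for i
  proof -
    consider "i = 0" | "i = n - 1" "i \<noteq> 0" | j where "i = Suc j" "j + 2 < n"
      using i by (cases i) force+
    then show ?thesis
    proof cases
      case 1
      have "nbhd (path_graph n) 0 = {1}"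
        using len len2 by (auto simp: nbhd_path_graph)
      then show ?thesis
        using 1 nth by (simp add: location_def L_def)
    next
      case 2
      have "nbhd (path_graph n) i = {n - 2}"
        using 2 len len2 by (auto simp: nbhd_path_graph)
      moreover have "L ! i = last L"
        using 2 lenL by (subst last_conv_nth) (auto simp: L_def)
      then have "L ! i = (t, {s, t})"
        by (simp add: L_def)
      ultimately show ?thesis
        using 2 nth by (simp add: location_def insert_commute)
    next
      case 3
      have "nbhd (path_graph n) i = {j, j + 2}"
        using 3 by (auto simp: nbhd_path_graph)
      moreover have "j < n - 2"
        using 3 by linarith
      then have "L ! i = inner_locations v ! j"
        using 3 len by (simp add: L_def nth_append)
      ultimately show ?thesis
        using 3 len by (simp add: location_def nth_inner_locations insert_commute)
    qed
  qed
  have inj: "inj_on (location (path_graph n) ((!) v)) {..<n}"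
    using distL lenL by (auto simp: inj_on_def loc nth_eq_iff_index_eq)
  have adj: "v ! i \<noteq> v ! Suc i" if "Suc i < n" for i
    using distinct_adj_nth[OF v(3)] that len by simp
  have path: "nl_function (path_graph n) ((!) v)"
    using inj adj by (auto simp: nl_function_def path_graph_def dest: adj[symmetric])
  have "(!) v ` {..<n} \<subseteq> K"
  proof
    fix c assume "c \<in> (!) v ` {..<n}"
    then obtain i where i: "i < n" "c = v ! i"
      by blast
    \<comment> \<open>The color of a vertex is the first component of its location, so the bound on
      locations also bounds the colors.\<close>
    then have "c = fst (L ! i)"
      using loc[of i] by (simp add: location_def flip: loc)
    moreover have "L ! i \<in> set L"
      using i lenL by simp
    moreover have "fst ` pointed (blocks K) \<subseteq> K"
      by (auto simp: pointed_def nsets_def)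
    then have "fst ` set L \<subseteq> K"
      using K image_mono[OF K(1), of fst] v(5) unfolding L_def by auto
    ultimately show "c \<in> K"
      by blast
  qed
  moreover have "nl_function (cycle_graph n) ((!) v)" if n3: "3 \<le> n" and eq: "(x, y) = (s, t)"
  proof -
    have "location (cycle_graph n) ((!) v) i = location (path_graph n) ((!) v) i" if i: "i < n" for i
    proof -
      consider "i = 0" | "i = n - 1" "i \<noteq> 0" | j where "i = Suc j" "j + 2 < n"
        using i by (cases i) force+
      then have "(!) v ` nbhd (cycle_graph n) i = (!) v ` nbhd (path_graph n) i"
      proof cases
        case 1
        have "nbhd (path_graph n) i = {1}" "nbhd (cycle_graph n) i = {1, n - 1}"
          using 1 n3 by (auto simp: nbhd_path_graph nbhd_cycle_graph)
        then show ?thesis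
          using nth eq by simp
      next
        case 2
        have "nbhd (path_graph n) i = {n - 2}" "nbhd (cycle_graph n) i = {0, n - 2}"
          using 2 n3 by (auto simp: nbhd_path_graph nbhd_cycle_graph mod_if)
        then show ?thesis
          using nth eq by simp
      next
        case 3
        have "nbhd (path_graph n) i = {j, j + 2}" "nbhd (cycle_graph n) i = {j + 2, j}"
          using 3 n3 by (auto simp: nbhd_path_graph nbhd_cycle_graph mod_if)
        then show ?thesis
          by auto
      qed
      then show ?thesis
        by (simp add: location_def)
    qed
    then have "inj_on (location (cycle_graph n) ((!) v)) {..<n}"
      using inj by (simp add: inj_on_def)
    moreover have "v ! i \<noteq> v ! ((i + 1) mod n)" if "i < n" for i
    proof (cases "Suc i < n")
      \<comment> \<open>The closing edge joins the colors \<open>y\<close> and \<open>x\<close>,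
        which already differ at the beginning of the sequence.\<close>
      case False
      then have "i = n - 1" using that by simp
      then show ?thesis
        using adj[of 0] nth eq n3 by simp
    qed (use adj in simp)
    ultimately show ?thesis
      by (force simp: nl_function_def cycle_graph_def)
  qed
  ultimately show ?thesis
    using path by blast
qed

section \<open>Lower bounds from counting locations and edges\<close>

lemma locations_in_blocks:
  assumes "nl_function G f"
    and nb: "\<And>u. u \<in> pverts G \<Longrightarrow> \<exists>v w. nbhd G u = {v, w} \<and> v \<in> pverts G \<and> w \<in> pverts G"
  shows "location G f ` pverts G \<subseteq> pointed (blocks (f ` pverts G))"
proof
  fix l assume "l \<in> location G f ` pverts G"
  then obtain u where u: "u \<in> pverts G" "l = location G f u"
    by blast
  obtain v w where vw: "nbhd G u = {v, w}" "v \<in> pverts G" "w \<in> pverts G"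
    using nb[OF u(1)] by blast
  have "f u \<noteq> f v" "f u \<noteq> f w"
    using assms(1) vw(1) by (auto simp: nl_function_def nbhd_def)
  then have "card {f u, f v, f w} = 2 \<or> card {f u, f v, f w} = 3"
    by (cases "f v = f w") auto
  with u vw show "l \<in> pointed (blocks (f ` pverts G))"
    by (auto simp: location_def pointed_def nsets_def)
qed

lemma card_verts_le_ell:
  assumes "nl_function G f" "finite (pverts G)"
    and "\<And>u. u \<in> pverts G \<Longrightarrow> \<exists>v w. nbhd G u = {v, w} \<and> v \<in> pverts G \<and> w \<in> pverts G"
  shows "card (pverts G) \<le> ell (card (f ` pverts G))"
proof -
  have "card (pverts G) = card (location G f ` pverts G)"
    using assms(1) by (simp add: nl_function_def card_image)
  also have "\<dots> \<le> card (pointed (blocks (f ` pverts G)))"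
    using finite_pointed_nsets[of "f ` pverts G" "blocks (f ` pverts G)"]
      locations_in_blocks[OF assms(1,3)] assms(2) by (intro card_mono) auto
  finally show ?thesis
    using assms(2) by (simp add: card_pointed_blocks)
qed

text \<open>At an end vertex both witnesses are its only neighbor, which lets the counting bound
  cover paths.\<close>

lemma nbhd_path_graph_pair:
  "2 \<le> n \<Longrightarrow> i < n \<Longrightarrow> \<exists>v w. nbhd (path_graph n) i = {v, w} \<and> v < n \<and> w < n"
  by (rule exI[of _ "if i = 0 then 1 else i - 1"],
      rule exI[of _ "if i + 1 < n then i + 1 else i - 1"]) (auto simp: nbhd_path_graph)

lemma path_lower_bound:
  assumes "2 \<le> n" "nl_function (path_graph n) f"
  shows "n \<le> ell (card (f ` {..<n}))"
  using card_verts_le_ell[OF assms(2)] nbhd_path_graph_pair[OF assms(1)]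
  by (simp add: path_graph_def)

lemma nbhd_cycle_graph_pair:
  "3 \<le> n \<Longrightarrow> i < n \<Longrightarrow> \<exists>v w. nbhd (cycle_graph n) i = {v, w} \<and> v < n \<and> w < n"
  using nbhd_cycle_graph[of n i] mod_less_divisor[of n] by (metis not_less_zero gr_zeroI)

lemma cycle_lower_bound:
  assumes "3 \<le> n" "nl_function (cycle_graph n) f"
  shows "n \<le> ell (card (f ` {..<n}))"
  using card_verts_le_ell[OF assms(2)] nbhd_cycle_graph_pair[OF assms(1)]
  by (simp add: cycle_graph_def)

text \<open>The sum of \<open>h c a\<close> over all conceivable locations is symmetric in the two
  colors, and so is the sum over the locations that occur, since every edge between the colors is
  seen once from either end. Hence the missing location \<open>l\<close> would have to contribute
  equally to \<open>h c a\<close> and \<open>h a c\<close>, but having color \<open>c\<close> it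
  contributes only to the former.\<close>

lemma cycle_deficiency:
  fixes f :: "nat \<Rightarrow> 'c"
  assumes n: "3 \<le> n" and f: "nl_function (cycle_graph n) f"
  shows "n + 1 \<noteq> ell (card (f ` {..<n}))"
proof
  assume deficient: "n + 1 = ell (card (f ` {..<n}))"
  let ?loc = "location (cycle_graph n) f" and ?Ty = "pointed (blocks (f ` {..<n}))"
  let ?s = "\<lambda>i. (i + 1) mod n" and ?p = "\<lambda>i. (i + (n - 1)) mod n"
  have verts: "pverts (cycle_graph n) = {..<n}"
    by (simp add: cycle_graph_def)
  have inj: "inj_on ?loc {..<n}"
    using f by (simp add: nl_function_def verts)
  have sub: "?loc ` {..<n} \<subseteq> ?Ty"
    using locations_in_blocks[OF f] nbhd_cycle_graph_pair[OF n] unfolding verts by simp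
  have fin: "finite ?Ty"
    by (intro finite_pointed_nsets[of "f ` {..<n}"]) auto
  have "card (?Ty - ?loc ` {..<n}) = 1"
    using deficient fin sub inj
    by (subst card_Diff_subset) (auto simp: card_image card_pointed_blocks)
  then obtain l where "?Ty - ?loc ` {..<n} = {l}"
    using card_1_singletonE by blast
  with sub have Ty: "?Ty = insert l (?loc ` {..<n})" "l \<notin> ?loc ` {..<n}"
    by blast+
  obtain c B where cB: "l = (c, B)"
    by (cases l)
  have "l \<in> ?Ty"
    unfolding Ty(1) by simp
  then have "c \<in> B" "B \<in> blocks (f ` {..<n})"
    unfolding cB pointed_def by simp_all
  then have l: "l = (c, B)" "c \<in> B" "card B = 2 \<or> card B = 3"
    using cB by (auto simp: nsets_def)
  have "\<not> B \<subseteq> {c}"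
    using l(3) card_mono[of "{c}" B] by auto
  then obtain a where a: "a \<in> B" "a \<noteq> c"
    by blast

  txt \<open>\<open>h x y r\<close> is the number of neighbors of color \<open>y\<close> that the location \<open>r\<close> prescribes to a vertex of
    color \<open>x\<close>: if \<open>card (snd r) = 2\<close>, both neighbors have the same color.\<close>
  define h :: "'c \<Rightarrow> 'c \<Rightarrow> 'c \<times> 'c set \<Rightarrow> nat" where
    "h x y r = (if fst r = x \<and> y \<in> snd r then if card (snd r) = 2 then 2 else 1 else 0)" for x y r
  \<comment> \<open>\<open>e x y\<close> counts the edges traversed from color \<open>x\<close> to
    color \<open>y\<close> when going around the cycle.\<close>
  define e where "e x y = (\<Sum>i<n. of_bool (f i = x \<and> f (?s i) = y) :: nat)" for x y
  have sp: "?s (?p i) = i" "?p (?s i) = i" if "i < n" for i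
  proof -
    have "?p i = (if i = 0 then n - 1 else i - 1)"
    proof (cases "i = 0")
      case False
      then have eq: "i + (n - 1) = (i - 1) + n"
        using n by simp
      show ?thesis
        unfolding eq mod_add_self2 using False that by simp
    qed (use n in simp)
    then show "?s (?p i) = i"
      using that n by (cases "i = 0") simp_all
    show "?p (?s i) = i"
    proof (cases "i + 1 = n")
      case True
      then show ?thesis
        by auto
    next
      case False
      then have "?s i = i + 1"
        using that by simp
      moreover have "i + 1 + (n - 1) = i + n"
        using n by simp
      ultimately show ?thesis
        using that by simp
    qed
  qed
  have adj: "f i \<noteq> f (?s i)" "f i \<noteq> f (?p i)" if "i < n" for i
    using f that n sp[OF that] by (auto simp: nl_function_def cycle_graph_def)
  have h_loc: "h x y (?loc i) = of_bool (f i = x \<and> f (?s i) = y) + of_bool (f i = x \<and> f (?p i) = y)"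
    if "x \<noteq> y" "i < n" for x y i
  proof -
    have "?loc i = (f i, {f i, f (?s i), f (?p i)})"
      using that n by (simp add: location_def nbhd_cycle_graph)
    then show ?thesis
      using that adj[OF that(2)] by (cases "f (?s i) = f (?p i)") (auto simp: h_def)
  qed
  \<comment> \<open>Passing to the predecessor turns these pairs into edges traversed from
    \<open>y\<close> to \<open>x\<close>.\<close>
  have "(\<Sum>i<n. of_bool (f i = x \<and> f (?p i) = y)) = e y x" for x y
    unfolding e_def using n sp
    by (intro sum.reindex_bij_witness[where i = ?s and j = ?p]) auto
  then have sum_loc: "(\<Sum>i<n. h x y (?loc i)) = e x y + e y x" if "x \<noteq> y" for x y
    using that by (simp add: h_loc sum.distrib e_def)
  have sum_Ty: "(\<Sum>r\<in>?Ty. h x y r) = h x y l + (e x y + e y x)" if "x \<noteq> y" for x y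
    unfolding Ty(1) using Ty(2) sum_loc[OF that] by (simp add: sum.reindex[OF inj])
  have "(\<Sum>r\<in>?Ty. h x y r) = (\<Sum>r | r \<in> ?Ty \<and> fst r = x \<and> y \<in> snd r. if card (snd r) = 2 then 2 else 1)" for x y
    unfolding h_def by (rule sum.inter_filter[OF fin, symmetric])
  \<comment> \<open>Exchanging the distinguished color keeps the color set, hence the
    weight.\<close>
  moreover have "(\<Sum>r | r \<in> ?Ty \<and> fst r = x \<and> y \<in> snd r. if card (snd r) = 2 then 2 else 1)
      = (\<Sum>r | r \<in> ?Ty \<and> fst r = y \<and> x \<in> snd r. if card (snd r) = 2 then 2 else 1 :: nat)" for x y
    by (rule sum.reindex_bij_witness[where i = "\<lambda>r. (x, snd r)" and j = "\<lambda>r. (y, snd r)"])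
      (auto simp: pointed_def)
  ultimately have "(\<Sum>r\<in>?Ty. h c a r) = (\<Sum>r\<in>?Ty. h a c r)"
    by simp
  then have "h c a l = h a c l"
    using a sum_Ty[of c a] sum_Ty[of a c] by simp
  then show False
    using l a by (simp add: h_def split: if_splits)
qed

section \<open>The chromatic numbers of paths and cycles\<close>

lemma nl_function_path_and_cycle:
  assumes m: "3 \<le> m" and n: "ell m \<le> n + 1" "n \<le> ell (Suc m)" "n + 1 \<noteq> ell (Suc m)" "3 \<le> n"
  shows "\<exists>f. nl_function (path_graph n) f \<and> nl_function (cycle_graph n) f \<and> f ` {..<n} \<subseteq> {..<Suc m}"
proof -
  obtain U A where U: "realizes 0 1 0 1 U A" "U \<subseteq> pointed (blocks {..<Suc m} - {{0, 1}})" "card U + 2 = n"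
    using realizes_two_ends[OF m n(1-3)] by blast
  have "(0, {0, 1}) \<notin> U" "(1, {0, 1}) \<notin> U" "(0, {0, 1}) \<noteq> (1 :: nat, {0, 1 :: nat})"
    using U(2) by (auto simp: pointed_def)
  moreover have "U \<subseteq> pointed (blocks {..<Suc m})"
    using U(2) by (auto simp: pointed_def)
  ultimately show ?thesis
    using nl_function_of_realization[OF U(1) _ _ _ _ _ _ U(3), of "{..<Suc m}"] n(4) m by auto
qed

lemma nl_function_path_deficient:
  assumes k: "3 \<le> k"
  shows "\<exists>f. nl_function (path_graph (ell k - 1)) f \<and> f ` {..<ell k - 1} \<subseteq> {..<k}"
proof -
  obtain U A where U: "realizes 0 1 1 2 U A" "U \<subseteq> pointed (blocks {..<k}) - {(0, {0, 1}), (2, {1, 2})}"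
    "card U + 3 = ell k"
    using realizes_all_but_one[OF k] by blast
  have "card U + 2 = ell k - 1"
    using U(3) by simp
  moreover have "(0, {0, 1}) \<notin> U" "(2, {1, 2}) \<notin> U" "U \<subseteq> pointed (blocks {..<k})"
    using U(2) by blast+
  ultimately show ?thesis
    using nl_function_of_realization[OF U(1), of "{..<k}" "ell k - 1"] k by auto
qed

lemma path_graph_chi_NL:
  assumes "ell (k - 1) < n" "2 \<le> n" "nl_function (path_graph n) f" "f ` {..<n} \<subseteq> {..<k}"
  shows "chi_NL (path_graph n) = k"
proof (rule chi_NL_eqI[OF pair_graph_path_graph assms(3)])
  have verts: "pverts (path_graph n) = {..<n}"
    by (simp add: path_graph_def)
  show "card (f ` pverts (path_graph n)) \<le> k"
    using card_mono[OF _ assms(4)] by (simp add: verts)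
  fix g :: "nat \<Rightarrow> nat set" assume "nl_function (path_graph n) g"
  then have "n \<le> ell (card (g ` {..<n}))"
    by (rule path_lower_bound[OF assms(2)])
  then have "\<not> card (g ` {..<n}) \<le> k - 1"
    using ell_mono[of "card (g ` {..<n})" "k - 1"] assms(1) by linarith
  then show "k \<le> card (g ` pverts (path_graph n))"
    by (simp add: verts)
qed

text \<open>The second alternative is the exceptional cycle: exactly \<open>k - 1\<close> colors
  fail by \<open>cycle_deficiency\<close>, and fewer colors fail by counting.\<close>

lemma cycle_graph_chi_NL:
  assumes "ell (k - 1) < n \<or> ell (k - 1) = n + 1 \<and> ell (k - 2) < n" "3 \<le> n"
    "nl_function (cycle_graph n) f" "f ` {..<n} \<subseteq> {..<k}"
  shows "chi_NL (cycle_graph n) = k"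
proof (rule chi_NL_eqI[OF pair_graph_cycle_graph[OF assms(2)] assms(3)])
  have verts: "pverts (cycle_graph n) = {..<n}"
    by (simp add: cycle_graph_def)
  show "card (f ` pverts (cycle_graph n)) \<le> k"
    using card_mono[OF _ assms(4)] by (simp add: verts)
  fix g :: "nat \<Rightarrow> nat set" assume g: "nl_function (cycle_graph n) g"
  let ?c = "card (g ` {..<n})"
  have c: "n \<le> ell ?c" "n + 1 \<noteq> ell ?c"
    using cycle_lower_bound[OF assms(2) g] cycle_deficiency[OF assms(2) g] by auto
  have "\<not> ?c \<le> k - 1"
  proof
    assume le: "?c \<le> k - 1"
    with c have "ell (k - 1) = n + 1" "ell (k - 2) < n"
      using ell_mono[OF le] assms(1) by auto
    moreover from this c have "?c \<noteq> k - 1"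
      by auto
    then have "?c \<le> k - 2"
      using le by linarith
    ultimately show False
      using ell_mono[of ?c "k - 2"] c by linarith
  qed
  then show "k \<le> card (g ` pverts (cycle_graph n))"
    by (simp add: verts)
qed

theorem theorem17:
  fixes k n :: nat
  assumes "k \<ge> 4" and "ell (k - 1) < n" and "n \<le> ell k"
  shows "chi_NL (path_graph n) = k
    \<and> (n \<noteq> ell k - 1 \<longrightarrow> chi_NL (cycle_graph n) = k)
    \<and> (n = ell k - 1 \<longrightarrow> chi_NL (cycle_graph n) = k + 1)"
proof -
  define m where "m = k - 1"
  have m: "k = Suc m" "3 \<le> m"
    using assms(1) by (auto simp: m_def)
  have n3: "3 \<le> n"
    using assms(2) three_le_choose_2[OF m(2)] by (simp add: m ell_eq_blocks)
  show ?thesis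
  proof (cases "n = ell k - 1")
    case False
    then have "n + 1 \<noteq> ell k"
      by auto
    then obtain f where "nl_function (path_graph n) f" "nl_function (cycle_graph n) f" "f ` {..<n} \<subseteq> {..<k}"
      using nl_function_path_and_cycle[OF m(2), of n] assms n3 by (auto simp: m(1))
    then show ?thesis
      using False assms n3 path_graph_chi_NL[of k n f] cycle_graph_chi_NL[of k n f] by simp
  next
    case True
    have Suc: "n + 1 = ell k"
      using True n3 by simp
    obtain f where "nl_function (path_graph n) f" "f ` {..<n} \<subseteq> {..<k}"
      using nl_function_path_deficient[of k] assms(1) True by auto
    then have "chi_NL (path_graph n) = k"
      using assms n3 path_graph_chi_NL[of k n f] by simp
    \<comment> \<open>The construction is applied with \<open>m = k\<close>, that is with
      \<open>k + 1\<close> colors; its lower bound on the length is attained with equality.\<close>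
    moreover obtain g where "nl_function (cycle_graph n) g" "g ` {..<n} \<subseteq> {..<Suc k}"
      using nl_function_path_and_cycle[of k n] assms Suc n3 by (auto simp: ell_Suc[of k])
    then have "chi_NL (cycle_graph n) = Suc k"
      using Suc assms n3 cycle_graph_chi_NL[of "Suc k" n g] by (simp add: numeral_2_eq_2)
    ultimately show ?thesis
      using True by simp
  qed
qed

end
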